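(* Suppose $F:\mathbb{R}^d\to\mathbb{R}$ attains minimum value $0$ and satisfies second-order self-bounding regularity with function $\rho_1$. Let $\epsilon>0$ and $w_0\in\mathbb{R}^d$. Run gradient descent (GD) initialized at $w_0$, with step size $\eta=\frac{1}{L_1(w_0)}$, where $$L_1(w_0)=\max\{1,\ \rho_0(F(w_0)+1),\ \rho_0(F(w_0))\,\rho_0(F(w_0)+1),\ \rho_1(F(w_0)+1)\}.$$ Then letting $$T=\frac{2F(w_0)L_1(w_0)}{\epsilon^2},$$ within $T+1$ oracle calls to $\nabla F(\cdot)$, GD will output $T$ candidate vectors $(p_1,\ldots,p_T)$, one of which satisfies $\|\nabla F(p_t)\|\le\epsilon$.
   Context: $\|\cdot\|$ is the Euclidean norm of vectors and $\|\cdot\|_{\mathrm{op}}$ the operator norm. Second-order self-bounding regularity: $F$ is twice differentiable and there is a non-decreasing function $\rho_1:\mathbb{R}_{\ge0}\to\mathbb{R}_{\ge0}$ such that $\|\nabla^2F(w)\|_{\mathrm{op}}\le\rho_1(F(w))$ for all $w\in\mathbb{R}^d$. Given $\rho_1$, define $\rho_0(x)=\rho_1(x)\sqrt{2\theta(x)}$ with $\theta(x)=\int_0^x\frac{1}{\rho_1(v)}\,dv$ for $x\ge0$. GD with step size $\eta$ is the iteration $w_{t+1}=w_t-\eta\nabla F(w_t)$; the candidate vectors it outputs are its successive iterates $w_0,w_1,\ldots$. *)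

theory Defs
  imports "HOL-Analysis.Analysis"
begin

definition gradient :: "('a::euclidean_space \<Rightarrow> real) \<Rightarrow> 'a \<Rightarrow> 'a" where
  "gradient F w = (THE D. GDERIV F w :> D)"

lemma gradient_eqI:
  assumes "GDERIV F w :> D"
  shows "gradient F w = D"
  unfolding gradient_def
proof (rule the_equality)
  fix D' assume "GDERIV F w :> D'"
  then have "(\<lambda>h. h \<bullet> D') = (\<lambda>h. h \<bullet> D)"
    using assms unfolding gderiv_def by (rule has_derivative_unique)
  then have "\<forall>h. h \<bullet> D' = h \<bullet> D"
    by (simp add: fun_eq_iff)
  then show "D' = D"
    by (rule vector_eq_ldot[THEN iffD1])
qed (rule assms)

lemma GDERIV_gradient:
  assumes "F differentiable (at w)"
  shows "GDERIV F w :> gradient F w"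
proof -
  obtain F' where F': "(F has_derivative F') (at w)"
    using assms by (auto simp: differentiable_def)
  then interpret linear F' by (rule has_derivative_linear)
  have "F' h = h \<bullet> (\<Sum>i\<in>Basis. F' i *\<^sub>R i)" for h
  proof -
    have "F' h = F' (\<Sum>i\<in>Basis. (h \<bullet> i) *\<^sub>R i)"
      by (simp only: euclidean_representation)
    also have "\<dots> = (\<Sum>i\<in>Basis. (h \<bullet> i) * F' i)"
      by (simp only: sum scale real_scaleR_def)
    also have "\<dots> = h \<bullet> (\<Sum>i\<in>Basis. F' i *\<^sub>R i)"
      by (simp only: inner_sum_right inner_scaleR_right mult.commute)
    finally show ?thesis .
  qed
  then have "F' = (\<lambda>h. h \<bullet> (\<Sum>i\<in>Basis. F' i *\<^sub>R i))"
    by (rule ext)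
  with F' have "GDERIV F w :> (\<Sum>i\<in>Basis. F' i *\<^sub>R i)"
    unfolding gderiv_def by (rule back_subst[where P = "\<lambda>f. (F has_derivative f) (at w)"])
  then show ?thesis
    by (simp only: gradient_eqI)
qed

text \<open>The Hessian is the linear map given by the derivative of the gradient, so that
  \<^const>\<open>onorm\<close> is its operator norm with respect to the Euclidean norm.\<close>

definition hessian :: "('a::euclidean_space \<Rightarrow> real) \<Rightarrow> 'a \<Rightarrow> 'a \<Rightarrow> 'a" where
  "hessian F w = frechet_derivative (gradient F) (at w)"

definition twice_differentiable :: "('a::euclidean_space \<Rightarrow> real) \<Rightarrow> bool" where
  "twice_differentiable F \<longleftrightarrow>
     (\<forall>w. F differentiable (at w)) \<and> (\<forall>w. gradient F differentiable (at w))"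

definition attains_minimum_value :: "('a \<Rightarrow> real) \<Rightarrow> real \<Rightarrow> bool" where
  "attains_minimum_value F m \<longleftrightarrow> (\<exists>w. F w = m) \<and> (\<forall>w. m \<le> F w)"

text \<open>The function \<open>\<rho>\<^sub>1\<close> on the nonnegative reals is a total real function of which
  only the values on \<open>{0..}\<close> matter.\<close>

definition second_order_self_bounding ::
    "('a::euclidean_space \<Rightarrow> real) \<Rightarrow> (real \<Rightarrow> real) \<Rightarrow> bool" where
  "second_order_self_bounding F \<rho>\<^sub>1 \<longleftrightarrow>
     twice_differentiable F \<and>
     (\<forall>x\<ge>0. 0 \<le> \<rho>\<^sub>1 x) \<and> mono_on {0..} \<rho>\<^sub>1 \<and>
     (\<forall>w. onorm (hessian F w) \<le> \<rho>\<^sub>1 (F w))"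

text \<open>The conventions \<open>1 / 0 = 0\<close> and "a divergent integral is \<open>0\<close>" take effect only
  if \<open>\<rho>\<^sub>1\<close> vanishes at a point \<open>> 0\<close> or \<open>1 / \<rho>\<^sub>1\<close> is not integrable at \<open>0\<close>. There the
  usual value of \<open>\<theta>\<close> would be infinite; in particular nothing is affected when
  \<open>\<rho>\<^sub>1 0 > 0\<close>.\<close>

definition theta :: "(real \<Rightarrow> real) \<Rightarrow> real \<Rightarrow> real" where
  "theta \<rho>\<^sub>1 x = integral {0..x} (\<lambda>v. 1 / \<rho>\<^sub>1 v)"

definition rho0 :: "(real \<Rightarrow> real) \<Rightarrow> real \<Rightarrow> real" where
  "rho0 \<rho>\<^sub>1 x = \<rho>\<^sub>1 x * sqrt (2 * theta \<rho>\<^sub>1 x)"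

definition L1 :: "('a \<Rightarrow> real) \<Rightarrow> (real \<Rightarrow> real) \<Rightarrow> 'a \<Rightarrow> real" where
  "L1 F \<rho>\<^sub>1 w\<^sub>0 = Max {1, rho0 \<rho>\<^sub>1 (F w\<^sub>0 + 1),
                        rho0 \<rho>\<^sub>1 (F w\<^sub>0) * rho0 \<rho>\<^sub>1 (F w\<^sub>0 + 1),
                        \<rho>\<^sub>1 (F w\<^sub>0 + 1)}"

text \<open>The state after \<open>n\<close> rounds of gradient descent with gradient oracle \<open>g\<close> and step
  size \<open>\<eta>\<close>: the current iterate \<open>w\<^sub>n\<close>, the list of candidate vectors output so far
  and the number of oracle calls made so far. A round outputs the current iterate, queries
  the oracle there once and makes the step, so the candidates \<open>p\<^sub>1, \<dots>, p\<^sub>n\<close> are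
  the iterates with indices \<open>0, \<dots>, n - 1\<close>.\<close>

primrec gd_run ::
    "('a::real_vector \<Rightarrow> 'a) \<Rightarrow> real \<Rightarrow> 'a \<Rightarrow> nat \<Rightarrow> 'a \<times> 'a list \<times> nat" where
  "gd_run g \<eta> w\<^sub>0 0 = (w\<^sub>0, [], 0)"
| "gd_run g \<eta> w\<^sub>0 (Suc n) =
     (case gd_run g \<eta> w\<^sub>0 n of (w, ps, calls) \<Rightarrow> (w - \<eta> *\<^sub>R g w, ps @ [w], calls + 1))"

text \<open>The number of candidates for a real budget \<open>T \<ge> 0\<close>. It is \<open>T\<close> itself when \<open>T\<close>
  is a positive integer; otherwise it is \<open>T\<close> rounded up, and one candidate if \<open>T = 0\<close>
  (which happens exactly when the initial point is already a minimiser).\<close>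

definition num_candidates :: "real \<Rightarrow> nat" where
  "num_candidates T = max 1 (nat \<lceil>T\<rceil>)"

end

theory Submission
  imports Defs
begin

text \<open>As long as gradient descent stays in the sublevel set \<open>{F \<le> F w\<^sub>0 + 1}\<close>, the Hessian is
  bounded by \<open>\<rho>\<^sub>1 (F w\<^sub>0 + 1) \<le> L1\<close>. A step of size \<open>1 / L1\<close> cannot leave this set: at the first
  exit point of the step's segment the quadratic upper bound would already force the value of
  \<open>F\<close> to be at most its value at the start of the step. Hence every step decreases \<open>F\<close> by at
  least \<open>\<parallel>\<nabla>F\<parallel>\<^sup>2 / (2 L1)\<close>, and telescoping gives the claim. The terms of \<open>L1\<close> involving \<open>\<rho>\<^sub>0\<close>
  play no role for gradient descent, so the junk values of \<open>\<theta>\<close> are harmless.\<close>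

text \<open>The Hessian is not assumed continuous, so the mean value inequality replaces an integral
  remainder. The half-open range of \<open>t\<close> leaves the endpoint \<open>w + d\<close> free,
  which is what an argument at a first exit point requires.\<close>

lemma quadratic_upper_bound:
  fixes F :: "'a::euclidean_space \<Rightarrow> real"
  assumes "twice_differentiable F"
    and hess: "\<And>t. t \<in> {0..<1} \<Longrightarrow> onorm (hessian F (w + t *\<^sub>R d)) \<le> L"
  shows "F (w + d) \<le> F w + gradient F w \<bullet> d + L / 2 * (norm d)\<^sup>2"
proof -
  \<comment> \<open>Up to the constant \<open>F w\<close>, this is the gap between \<open>F\<close>
    and its quadratic model along the segment, so the claim becomes
    \<open>\<psi> 1 \<le> \<psi> 0\<close>.\<close>
  define \<psi> where "\<psi> t = F (w + t *\<^sub>R d) - t * (gradient F w \<bullet> d) - L / 2 * t\<^sup>2 * (norm d)\<^sup>2" for t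
  have F: "(F has_derivative (\<lambda>h. h \<bullet> gradient F v)) (at v)" for v
    using GDERIV_gradient assms(1) by (auto simp: twice_differentiable_def gderiv_def)
  have G: "(gradient F has_derivative hessian F v) (at v)" for v
    using assms(1) by (auto simp: twice_differentiable_def hessian_def frechet_derivative_works)
  have \<psi>_deriv: "(\<psi> has_real_derivative
      (d \<bullet> gradient F (w + t *\<^sub>R d) - gradient F w \<bullet> d - L * t * (norm d)\<^sup>2)) (at t)" for t
  proof -
    have "((\<lambda>t. F (w + t *\<^sub>R d)) has_derivative (\<lambda>h. (h *\<^sub>R d) \<bullet> gradient F (w + t *\<^sub>R d))) (at t)"
      by (rule has_derivative_compose[OF _ F]) (auto intro!: derivative_eq_intros)
    then have "((\<lambda>t. F (w + t *\<^sub>R d)) has_real_derivative d \<bullet> gradient F (w + t *\<^sub>R d)) (at t)"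
      by (simp add: has_field_derivative_def mult.commute[of _ "_ \<bullet> _"])
    then show ?thesis
      unfolding \<psi>_def by (auto intro!: derivative_eq_intros)
  qed
  have "\<psi> 1 \<le> \<psi> 0"
  proof (rule DERIV_nonpos_imp_decreasing_open[where f = \<psi>])
    fix t :: real assume t: "0 < t" "t < 1"
    have seg: "onorm (hessian F v) \<le> L" if "v \<in> closed_segment w (w + t *\<^sub>R d)" for v
    proof -
      from that obtain u where u: "0 \<le> u" "u \<le> 1" "v = w + (u * t) *\<^sub>R d"
        by (auto simp: in_segment algebra_simps)
      moreover have "u * t < 1"
        using mult_right_mono[of u 1 t] u t by linarith
      ultimately show ?thesis
        using hess[of "u * t"] t by simp
    qed
    have "norm (gradient F (w + t *\<^sub>R d) - gradient F w) \<le> L * norm (w + t *\<^sub>R d - w)"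
    proof (rule differentiable_bound)
      show "(gradient F has_derivative hessian F v) (at v within closed_segment w (w + t *\<^sub>R d))" for v
        by (rule has_derivative_at_withinI[OF G])
    qed (use seg in auto)
    then have "norm (gradient F (w + t *\<^sub>R d) - gradient F w) \<le> L * t * norm d"
      using t by simp
    then have "(gradient F (w + t *\<^sub>R d) - gradient F w) \<bullet> d \<le> L * t * norm d * norm d"
      by (meson mult_right_mono norm_cauchy_schwarz norm_ge_zero order_trans)
    then show "\<exists>y. DERIV \<psi> t :> y \<and> y \<le> 0"
      using \<psi>_deriv[of t] by (auto simp: inner_diff_left inner_commute power2_eq_square algebra_simps)
  next
    show "continuous_on {0..1} \<psi>"
      by (rule DERIV_continuous_on[OF has_field_derivative_at_within[OF \<psi>_deriv]])
  qed simp
  then show ?thesis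
    by (simp add: \<psi>_def)
qed

lemma gradient_step_decrease:
  fixes F :: "'a::euclidean_space \<Rightarrow> real"
  assumes tw: "twice_differentiable F"
    and hess: "\<And>v. F v \<le> c \<Longrightarrow> onorm (hessian F v) \<le> L"
    and "F w < c" "L > 0"
  shows "F (w - (1 / L) *\<^sub>R gradient F w) \<le> F w - (norm (gradient F w))\<^sup>2 / (2 * L)"
proof -
  define g where "g = gradient F w"
  \<comment> \<open>A partial step of fraction \<open>t\<close>: the displacement
    \<open>- (t / L) *\<^sub>R g\<close> contributes \<open>- t / L + t\<^sup>2 / (2 * L)\<close>
    times the squared norm of \<open>g\<close>. Only points strictly before \<open>t\<close> are
    assumed to lie in the sublevel set.\<close>
  have bound: "F (w - (t / L) *\<^sub>R g) \<le> F w - (2 * t - t\<^sup>2) * (norm g)\<^sup>2 / (2 * L)"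
    if t: "0 \<le> t" and le: "\<And>s. 0 \<le> s \<Longrightarrow> s < t \<Longrightarrow> F (w - (s / L) *\<^sub>R g) \<le> c" for t
  proof -
    have "onorm (hessian F (w + u *\<^sub>R - ((t / L) *\<^sub>R g))) \<le> L" if "u \<in> {0..<1}" for u
    \<comment> \<open>For \<open>t = 0\<close> the assumption \<open>le\<close> is vacuous, and
      \<open>F w < c\<close> supplies the Hessian bound.\<close>
    proof (cases "t = 0")
      case False
      then have "u * t < t" "0 \<le> u * t"
        using that t by auto
      from hess[OF le[OF this(2,1)]] show ?thesis
        by simp
    qed (use \<open>F w < c\<close> hess[of w] in simp)
    from quadratic_upper_bound[OF tw this]
    have "F (w - (t / L) *\<^sub>R g) \<le> F w - t / L * (g \<bullet> g) + L / 2 * (t / L * norm g)\<^sup>2"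
      using t \<open>L > 0\<close> by (simp add: g_def)
    also have "\<dots> = F w - (2 * t - t\<^sup>2) * (norm g)\<^sup>2 / (2 * L)"
      using \<open>L > 0\<close> by (simp add: power2_norm_eq_inner[symmetric] field_simps power2_eq_square)
    finally show ?thesis .
  qed
  have "F (w - (s / L) *\<^sub>R g) \<le> c" if s: "0 \<le> s" "s \<le> 1" for s
  proof (rule ccontr)
    assume exit: "\<not> ?thesis"
    \<comment> \<open>The non-strict inequality makes \<open>S\<close> closed, hence compact; its
      least element is the first exit time.\<close>
    define S where "S = {t \<in> {0..1}. c \<le> F (w - (t / L) *\<^sub>R g)}"
    have "continuous_on UNIV F"
      using tw by (auto simp: twice_differentiable_def intro!: differentiable_imp_continuous_on
          differentiable_at_imp_differentiable_on)
    then have "continuous_on {0..1} (\<lambda>t. F (w - (t / L) *\<^sub>R g))"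
      by (rule continuous_on_compose2) (use \<open>L > 0\<close> in \<open>auto intro!: continuous_intros\<close>)
    then have "closed S"
      using continuous_closed_preimage[OF _ closed_real_atLeastAtMost closed_real_atLeast]
      by (auto simp: S_def vimage_def Int_def)
    moreover have "bounded S"
      by (rule bounded_subset[of "{0..1}"]) (auto simp: S_def)
    moreover have "s \<in> S"
      using s exit by (auto simp: S_def)
    ultimately obtain t where t: "t \<in> S" and first: "\<And>s. s \<in> S \<Longrightarrow> t \<le> s"
      using compact_attains_inf[of S] by (auto simp: compact_eq_bounded_closed)
    have t01: "0 \<le> t" "t \<le> 1" "c \<le> F (w - (t / L) *\<^sub>R g)"
      using t by (auto simp: S_def)
    have "F (w - (s / L) *\<^sub>R g) < c" if "0 \<le> s" "s < t" for s
      using first[of s] that t01 by (force simp: S_def)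
    then have "F (w - (t / L) *\<^sub>R g) \<le> F w - (2 * t - t\<^sup>2) * (norm g)\<^sup>2 / (2 * L)"
      using bound[of t] t01 by (simp add: less_imp_le)
    \<comment> \<open>The decrease term is thus nonnegative, so the value at the exit point is at
      most \<open>F w < c\<close>, a contradiction.\<close>
    moreover have "t\<^sup>2 \<le> 2 * t"
      using mult_right_mono[of t 2 t] t01 by (simp add: power2_eq_square)
    ultimately show False
      using t01 \<open>F w < c\<close> \<open>L > 0\<close> by (smt (verit) divide_nonneg_pos mult_nonneg_nonneg zero_le_power2)
  qed
  from bound[of 1, OF _ this] show ?thesis
    by (simp add: g_def)
qed

lemma gd_run_eq:
  "gd_run g \<eta> w n =
     (((\<lambda>v. v - \<eta> *\<^sub>R g v) ^^ n) w, map (\<lambda>i. ((\<lambda>v. v - \<eta> *\<^sub>R g v) ^^ i) w) [0..<n], n)"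
  by (induction n) auto

theorem theorem3p1:
  fixes F :: "real ^ 'd \<Rightarrow> real"
    and \<rho>\<^sub>1 :: "real \<Rightarrow> real"
    and \<epsilon> \<eta> T :: real
    and w\<^sub>0 :: "real ^ 'd"
  assumes "attains_minimum_value F 0"
    and "second_order_self_bounding F \<rho>\<^sub>1"
    and "\<epsilon> > 0"
    and "\<eta> = 1 / L1 F \<rho>\<^sub>1 w\<^sub>0"
    and "T = 2 * F w\<^sub>0 * L1 F \<rho>\<^sub>1 w\<^sub>0 / \<epsilon>\<^sup>2"
  shows "\<exists>w ps calls.
           gd_run (gradient F) \<eta> w\<^sub>0 (num_candidates T) = (w, ps, calls) \<and>
           real calls \<le> T + 1 \<and>
           length ps = num_candidates T \<and>
           (\<exists>p \<in> set ps. norm (gradient F p) \<le> \<epsilon>)"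
proof -
  define L where "L = L1 F \<rho>\<^sub>1 w\<^sub>0"
  define N where "N = num_candidates T"
  define x where "x i = ((\<lambda>v. v - \<eta> *\<^sub>R gradient F v) ^^ i) w\<^sub>0" for i
  have nonneg: "0 \<le> F v" for v
    using assms(1) by (simp add: attains_minimum_value_def)
  have tw: "twice_differentiable F" and \<rho>_bound: "onorm (hessian F v) \<le> \<rho>\<^sub>1 (F v)"
    and \<rho>_mono: "mono_on {0..} \<rho>\<^sub>1" for v
    using assms(2) by (auto simp: second_order_self_bounding_def)
  have L: "1 \<le> L" "\<rho>\<^sub>1 (F w\<^sub>0 + 1) \<le> L"
    by (simp_all add: L_def L1_def)
  \<comment> \<open>The margin \<open>1\<close> above \<open>F w\<^sub>0\<close> provides the strict
    inequality \<open>F w < c\<close> for every iterate whose value is at most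
    \<open>F w\<^sub>0\<close>.\<close>
  have hess: "onorm (hessian F v) \<le> L" if "F v \<le> F w\<^sub>0 + 1" for v
    using \<rho>_bound[of v] mono_onD[OF \<rho>_mono, of "F v" "F w\<^sub>0 + 1"] L(2) nonneg that by force
  have step: "F (x (Suc i)) \<le> F (x i) - (norm (gradient F (x i)))\<^sup>2 / (2 * L)"
    if "F (x i) \<le> F w\<^sub>0" for i
    using gradient_step_decrease[OF tw hess, where w = "x i"] that L
    by (simp add: x_def assms(4) L_def)
  have sublevel: "F (x i) \<le> F w\<^sub>0" for i
  proof (induction i)
    case (Suc i)
    moreover have "0 \<le> (norm (gradient F (x i)))\<^sup>2 / (2 * L)"
      using L by simp
    ultimately show ?case
      using step[OF Suc] by linarith
  qed (simp add: x_def)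
  have sum: "F (x n) + (\<Sum>i<n. (norm (gradient F (x i)))\<^sup>2) / (2 * L) \<le> F w\<^sub>0" for n
  proof (induction n)
    case (Suc n)
    then show ?case
      using step[OF sublevel[of n]] by (simp add: add_divide_distrib)
  qed (simp add: x_def)
  have T: "0 \<le> T"
    using nonneg[of w\<^sub>0] L by (simp add: assms(5) L_def)
  \<comment> \<open>Rounding up costs less than one extra call; the maximum with \<open>1\<close>
    keeps the range of indices nonempty when \<open>T = 0\<close>.\<close>
  have N: "T \<le> N" "0 < N" "real N \<le> T + 1"
    using T unfolding N_def num_candidates_def by linarith+
  have "\<exists>i<N. norm (gradient F (x i)) \<le> \<epsilon>"
  proof (rule ccontr)
    assume "\<not> ?thesis"
    then have "\<epsilon>\<^sup>2 < (norm (gradient F (x i)))\<^sup>2" if "i < N" for i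
      using that \<open>\<epsilon> > 0\<close> by (intro power_strict_mono) auto
    \<comment> \<open>With all gradients longer than \<open>\<epsilon>\<close>, the sum exceeds
      \<open>N * \<epsilon>\<^sup>2\<close>, while telescoping and \<open>F (x N) \<ge> 0\<close>
      cap it at \<open>T * \<epsilon>\<^sup>2\<close>. Strictness uses \<open>0 < N\<close>.\<close>
    then have "(\<Sum>i<N. \<epsilon>\<^sup>2) < (\<Sum>i<N. (norm (gradient F (x i)))\<^sup>2)"
      using N(2) by (intro sum_strict_mono) auto
    also have "\<dots> \<le> 2 * F w\<^sub>0 * L"
      using sum[of N] nonneg[of "x N"] L by (simp add: field_simps)
         (smt (verit) mult_nonneg_nonneg)
    also have "\<dots> = T * \<epsilon>\<^sup>2"
      using \<open>\<epsilon> > 0\<close> by (simp add: assms(5) L_def)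
    finally show False
      using N(1) \<open>\<epsilon> > 0\<close> by simp
  qed
  then show ?thesis
    using N(3) by (auto simp: gd_run_eq x_def[symmetric] N_def[symmetric])
qed

end
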